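(* The calculus $\mathrm{SEQ}_\omega^{\mathrm{PDL}}$ is sound and complete with respect to $\mathbf{PDL}$: a sequent is derivable in $\mathrm{SEQ}_\omega^{\mathrm{PDL}}$ if and only if it is $\mathbf{PDL}$-valid. Moreover, any $\mathbf{PDL}$-valid sequent (in particular, formula) is derivable in $\mathrm{SEQ}_\omega^{\mathrm{PDL}}$ using ordinals $<\omega+\omega=\omega\cdot2$.
   Context: **Syntax.** Programs ($\mathrm{PRO}$, denoted $P,Q,R$) are generated from program variables $\pi_0,\pi_1,\dots$ by $P;Q$, $P\cup Q$, $P^*$. Formulas (seq-formulas) are built from literals $x,\neg x$ ($x$ a formula variable) by $\vee$, $\wedge$ and the modal operations $[P]A$, $\langle P\rangle A$ for $P\in\mathrm{PRO}$. The negation $\overline F$ is defined by $\overline{x}=\neg x$, $\overline{\neg x}=x$, $\overline{A\vee B}=\overline A\wedge\overline B$, $\overline{A\wedge B}=\overline A\vee\overline B$, $\overline{\langle P\rangle A}=[P]\overline A$, $\overline{[P]A}=\langle P\rangle\overline A$; $A\to B$ is $\overline A\vee B$. Write $\langle P\rangle^m$, $[P]^m$ for $m$-fold iteration; for $\chi\in\{0,1\}$ let $(P)_\chi=[P]$ if $\chi=1$ and $(P)_\chi=\langle P\rangle$ if $\chi=0$. For a finite (possibly empty) list $\overrightarrow Q=Q_1,\dots,Q_k$ of programs, $\langle\overrightarrow Q\rangle=\langle Q_1\rangle\cdots\langle Q_k\rangle$ and $[\overrightarrow Q]=[Q_1]\cdots[Q_k]$. Sequents are finite multisets of formulas; commas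 denote multiset union. **$\mathbf{PDL}$ and validity.** In a Kripke model each atomic program is interpreted by a binary relation on states; $;$ is composition, $\cup$ union, ${}^*$ reflexive-transitive closure; $[P]A$ (resp. $\langle P\rangle A$) holds at $u$ iff $A$ holds at all (resp. some) $v$ with $u\,R_P\,v$. A formula is $\mathbf{PDL}$-valid iff it holds at all states of all Kripke models; equivalently (Segerberg's known soundness and completeness), iff it is provable in the Hilbert system with axioms: classical propositional logic; $[P](A\to B)\to([P]A\to[P]B)$; $[P;Q]A\leftrightarrow[P][Q]A$; $[P\cup Q]A\leftrightarrow[P]A\wedge[Q]A$; $[P^*]A\leftrightarrow A\wedge[P][P^*]A$; $[P^*](A\to[P]A)\to(A\to[P^*]A)$; and rules modus ponens and $A/[P]A$. A sequent is valid iff the disjunction of its formulas is. **The calculus $\mathrm{SEQ}_\omega^{\mathrm{PDL}}$.** Axiom (Ax): $x,\neg x,\Gamma$. Rules (premises $\Rightarrow$ conclusion): - $(\vee)$: $A,B,\Gamma\Rightarrow A\vee B,\Gamma$. $(\wedge)$: $A,\Gamma$ and $B,\Gamma\Rightarrow A\wedge B,\Gamma$. - $\langle\cup\rangle$: $\langle P\rangle A,\langle R\rangle A,\Gamma\Rightarrow\langle P\cup R\rangle A,\Gamma$. $[\cup]$: $[P]A,\Gamma$ and $[R]A,\Gamma\Rightarrow[P\cup R]A,\Gamma$. - $\langle;\rangle$: $\langle P\rangle\langle R\rangle A,\Gamma\Rightarrow\langle P;R\rangle A,\Gamma$. $[;]$: $[P][R]A,\Gamma\Rightarrow[P;R]A,\Gamma$.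 - $\langle*\rangle$: $\langle\overrightarrow Q\rangle\langle P\rangle^mA,\langle\overrightarrow Q\rangle\langle P^*\rangle A,\Gamma\Rightarrow\langle\overrightarrow Q\rangle\langle P^*\rangle A,\Gamma$ (any $m\ge0$). - $[*]$ (the $\omega$-rule): $[\overrightarrow Q][P]^mA,\Gamma$ for all $m\ge0$ $\Rightarrow[\overrightarrow Q][P^*]A,\Gamma$. - (Gen): $A_1,\dots,A_n\Rightarrow(P)_{\chi_1}A_1,\dots,(P)_{\chi_n}A_n,\Gamma$, where $n>0$ and $\sum_{i=1}^n\chi_i=1$. - (Cut): $C,\Gamma$ and $\overline C,\Pi\Rightarrow\Gamma\cup\Pi$. Derivations are well-founded (possibly infinite) trees whose nodes are supplied with ordinals such that ordinals of premises are smaller than those of the corresponding conclusions; "using ordinals $<\alpha$" means all these ordinals can be chosen below $\alpha$. *)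

theory Defs
  imports
    "HOL-Library.Multiset"
    "HOL-Library.Product_Lexorder"
    "HOL-Library.Infinite_Typeclass"
begin

datatype prog =
    PVar nat
  | Comp prog prog
  | Choice prog prog
  | Star prog

datatype form =
    Pos nat
  | Neg nat
  | Or form form
  | And form form
  | Box prog form
  | Dia prog form

primrec neg :: "form \<Rightarrow> form" where
  "neg (Pos x) = Neg x"
| "neg (Neg x) = Pos x"
| "neg (Or A B) = And (neg A) (neg B)"
| "neg (And A B) = Or (neg A) (neg B)"
| "neg (Dia P A) = Box P (neg A)"
| "neg (Box P A) = Dia P (neg A)"

definition modal :: "nat \<Rightarrow> prog \<Rightarrow> form \<Rightarrow> form" where
  "modal \<chi> P A = (if \<chi> = 1 then Box P A else Dia P A)"

definition boxes :: "prog list \<Rightarrow> form \<Rightarrow> form" where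
  "boxes Qs A = foldr Box Qs A"

definition dias :: "prog list \<Rightarrow> form \<Rightarrow> form" where
  "dias Qs A = foldr Dia Qs A"

type_synonym sequent = "form multiset"

text \<open>The states of a model form an arbitrary subset of the type \<open>'s\<close>.\<close>

record 's kripke =
  states :: "'s set"
  rel :: "nat \<Rightarrow> ('s \<times> 's) set"
  val :: "nat \<Rightarrow> 's set"

definition kripke_model :: "'s kripke \<Rightarrow> bool" where
  "kripke_model M \<longleftrightarrow>
     states M \<noteq> {} \<and> (\<forall>i. rel M i \<subseteq> states M \<times> states M) \<and> (\<forall>x. val M x \<subseteq> states M)"

text \<open>The intersection makes the closure reflexive on the states of the model only.\<close>

primrec prog_rel :: "'s kripke \<Rightarrow> prog \<Rightarrow> ('s \<times> 's) set" where
  "prog_rel M (PVar i) = rel M i"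
| "prog_rel M (Comp P Q) = prog_rel M P O prog_rel M Q"
| "prog_rel M (Choice P Q) = prog_rel M P \<union> prog_rel M Q"
| "prog_rel M (Star P) = (prog_rel M P)\<^sup>* \<inter> (states M \<times> states M)"

primrec holds :: "'s kripke \<Rightarrow> 's \<Rightarrow> form \<Rightarrow> bool" where
  "holds M u (Pos x) \<longleftrightarrow> u \<in> val M x"
| "holds M u (Neg x) \<longleftrightarrow> u \<notin> val M x"
| "holds M u (Or A B) \<longleftrightarrow> holds M u A \<or> holds M u B"
| "holds M u (And A B) \<longleftrightarrow> holds M u A \<and> holds M u B"
| "holds M u (Box P A) \<longleftrightarrow> (\<forall>v. (u, v) \<in> prog_rel M P \<longrightarrow> holds M v A)"
| "holds M u (Dia P A) \<longleftrightarrow> (\<exists>v. (u, v) \<in> prog_rel M P \<and> holds M v A)"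

text \<open>
  HOL cannot quantify over all types inside a formula, so validity carries the type \<open>'s\<close> from
  which states are drawn as a parameter. When \<open>'s\<close> is infinite, every finite or countable model
  has an isomorphic copy with states in \<open>'s\<close>; a statement for every infinite \<open>'s\<close> concerns models
  of all cardinalities.
\<close>

definition form_valid :: "'s itself \<Rightarrow> form \<Rightarrow> bool" where
  "form_valid _ A \<longleftrightarrow> (\<forall>M :: 's kripke. kripke_model M \<longrightarrow> (\<forall>u \<in> states M. holds M u A))"

text \<open>
  This is validity of the disjunction of the formulas of \<open>\<Gamma>\<close>; it is written out semantically
  because the empty disjunction is not a formula. The empty sequent is not valid.
\<close>

definition seq_valid :: "'s itself \<Rightarrow> sequent \<Rightarrow> bool" where
  "seq_valid _ \<Gamma> \<longleftrightarrow>
     (\<forall>M :: 's kripke. kripke_model M \<longrightarrow> (\<forall>u \<in> states M. \<exists>A. A \<in># \<Gamma> \<and> holds M u A))"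

text \<open>
  \<open>inference S \<Gamma>\<close> says that \<open>\<Gamma>\<close> is the conclusion of an axiom or rule whose premises are exactly
  the members of \<open>S\<close>. In \<open>Gen\<close> the list \<open>xs\<close> consists of the pairs of an index in \<open>{0, 1}\<close> and
  a formula.
\<close>

inductive inference :: "sequent set \<Rightarrow> sequent \<Rightarrow> bool" where
  Ax: "inference {} ({#Pos x, Neg x#} + \<Gamma>)"
| OrR: "inference {{#A, B#} + \<Gamma>} ({#Or A B#} + \<Gamma>)"
| AndR: "inference {{#A#} + \<Gamma>, {#B#} + \<Gamma>} ({#And A B#} + \<Gamma>)"
| DiaChoice: "inference {{#Dia P A, Dia R A#} + \<Gamma>} ({#Dia (Choice P R) A#} + \<Gamma>)"
| BoxChoice: "inference {{#Box P A#} + \<Gamma>, {#Box R A#} + \<Gamma>} ({#Box (Choice P R) A#} + \<Gamma>)"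
| DiaComp: "inference {{#Dia P (Dia R A)#} + \<Gamma>} ({#Dia (Comp P R) A#} + \<Gamma>)"
| BoxComp: "inference {{#Box P (Box R A)#} + \<Gamma>} ({#Box (Comp P R) A#} + \<Gamma>)"
| DiaStar:
    "inference {{#dias Qs ((Dia P ^^ m) A), dias Qs (Dia (Star P) A)#} + \<Gamma>}
       ({#dias Qs (Dia (Star P) A)#} + \<Gamma>)"
| BoxStar:
    "inference {{#boxes Qs ((Box P ^^ m) A)#} + \<Gamma> | m. True}
       ({#boxes Qs (Box (Star P) A)#} + \<Gamma>)"
| Gen:
    "xs \<noteq> [] \<Longrightarrow> \<forall>(\<chi>, A) \<in> set xs. \<chi> \<in> {0, 1} \<Longrightarrow> (\<Sum>(\<chi>, A) \<leftarrow> xs. \<chi>) = 1 \<Longrightarrow>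
     inference {mset (map snd xs)} (mset (map (\<lambda>(\<chi>, A). modal \<chi> P A) xs) + \<Gamma>)"
| Cut: "inference {{#C#} + \<Gamma>, {#neg C#} + \<Pi>} (\<Gamma> + \<Pi>)"

text \<open>
  Existence of a well-founded derivation tree; such a tree always admits an assignment of ordinals
  decreasing from conclusions to premises, namely its ranks.
\<close>

inductive derivable :: "sequent \<Rightarrow> bool" where
  "inference S \<Gamma> \<Longrightarrow> (\<And>\<Delta>. \<Delta> \<in> S \<Longrightarrow> derivable \<Delta>) \<Longrightarrow> derivable \<Gamma>"

text \<open>
  Existence of a derivation whose nodes are labelled by elements of a well-order, the labels of
  premises being smaller than that of the conclusion, and whose root is labelled by \<open>\<alpha>\<close>.
\<close>

inductive derivable_ord :: "'o::wellorder \<Rightarrow> sequent \<Rightarrow> bool" where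
  "inference S \<Gamma> \<Longrightarrow> (\<And>\<Delta>. \<Delta> \<in> S \<Longrightarrow> \<exists>\<beta> < \<alpha>. derivable_ord \<beta> \<Delta>) \<Longrightarrow> derivable_ord \<alpha> \<Gamma>"

text \<open>Since the root carries the largest label, bounding it bounds all labels.\<close>

definition derivable_below :: "'o::wellorder \<Rightarrow> sequent \<Rightarrow> bool" where
  "derivable_below \<alpha> \<Gamma> \<longleftrightarrow> (\<exists>\<beta> < \<alpha>. derivable_ord \<beta> \<Gamma>)"

text \<open>
  In the lexicographic order on \<open>nat \<times> nat\<close>, which has order type \<open>\<omega>\<^sup>2\<close>, the pair \<open>(a, b)\<close> is the
  ordinal \<open>\<omega> \<cdot> a + b\<close>.
\<close>

definition omega_times_2 :: "nat \<times> nat" where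
  "omega_times_2 = (2, 0)"

end

theory Submission imports Defs begin

text \<open>
  With cut available it suffices to derive the principles of Segerberg's axiomatisation. The
  \<open>\<omega>\<close>-rule is needed only for the fixpoint and induction axioms of \<open>P\<^sup>*\<close>, and there all its premises
  have finite derivations: identities \<open>A, neg A\<close> are proved without unwinding \<open>P\<^sup>*\<close>, by \<open>Gen\<close> applied
  to \<open>P\<^sup>*\<close> itself. Hence these axioms have label \<open>\<omega>\<close>, and finitely many finitary inferences stay
  below \<open>\<omega> \<cdot> 2\<close>. An underivable sequent is then refuted as in Kozen and Parikh's completeness proof
  for PDL, in a finite model built from the maximal underivable subsets of its Fischer--Ladner closure.
\<close>

section \<open>Negation as an involution\<close>

lemma neg_neg [simp]: "neg (neg A) = A"
  by (induction A) auto

lemma neg_funpow_Dia: "neg ((Dia P ^^ m) A) = (Box P ^^ m) (neg A)"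
  by (induction m) auto

lemma neg_funpow_Box: "neg ((Box P ^^ m) A) = (Dia P ^^ m) (neg A)"
  by (induction m) auto

section \<open>Soundness\<close>

lemma holds_neg [simp]: "holds M u (neg A) \<longleftrightarrow> \<not> holds M u A"
  by (induction A arbitrary: u) auto

lemma rtrancl_in_states:
  assumes "(u, v) \<in> R\<^sup>*" "R \<subseteq> S \<times> S" "u \<in> S"
  shows "v \<in> S"
  using assms by (induction rule: rtrancl_induct) auto

lemma prog_rel_states:
  assumes "kripke_model M"
  shows "prog_rel M P \<subseteq> states M \<times> states M"
  using assms by (induction P) (auto simp: kripke_model_def)

lemma holds_funpow_Dia: "holds M u ((Dia P ^^ m) A) \<longleftrightarrow> (\<exists>v. (u, v) \<in> prog_rel M P ^^ m \<and> holds M v A)"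
proof (induction m arbitrary: u)
  case (Suc m)
  show ?case
    \<comment> \<open>\<open>relpow\<close> splits off its last factor by definition, whereas the
      iterated diamond starts with its first one.\<close>
    by (simp add: Suc del: relpow.simps) (meson relpow_Suc_I2 relpow_Suc_D2)
qed auto

lemma holds_funpow_Box: "holds M u ((Box P ^^ m) A) \<longleftrightarrow> (\<forall>v. (u, v) \<in> prog_rel M P ^^ m \<longrightarrow> holds M v A)"
  using holds_funpow_Dia[of M u m P "neg A"] holds_neg[of M u "(Box P ^^ m) A"]
  by (auto simp: neg_funpow_Box)

text \<open>From a state \<open>u\<close> only states are reachable, so the intersection in the
  meaning of \<open>Star P\<close> removes nothing.\<close>

lemma prog_rel_Star:
  assumes "kripke_model M" "u \<in> states M"
  shows "(u, v) \<in> prog_rel M (Star P) \<longleftrightarrow> (\<exists>m. (u, v) \<in> prog_rel M P ^^ m)"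
proof -
  have "(u, v) \<in> (prog_rel M P)\<^sup>* \<Longrightarrow> v \<in> states M"
    using rtrancl_in_states prog_rel_states assms by metis
  then show ?thesis
    using assms by (auto simp: rtrancl_power)
qed

lemma holds_dias_mono:
  assumes "kripke_model M" "\<And>v. v \<in> states M \<Longrightarrow> holds M v A \<Longrightarrow> holds M v B"
    and "u \<in> states M" "holds M u (dias Qs A)"
  shows "holds M u (dias Qs B)"
  using assms(3,4)
proof (induction Qs arbitrary: u)
  case Nil
  then show ?case using assms(2) by (simp add: dias_def)
next
  case (Cons Q Qs)
  from Cons.prems obtain v where v: "(u, v) \<in> prog_rel M Q" "holds M v (dias Qs A)"
    by (auto simp: dias_def)
  have "v \<in> states M"
    using v prog_rel_states[OF assms(1), of Q] by auto
  with v Cons.IH show ?case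
    by (auto simp: dias_def)
qed

text \<open>This is the semantic content of the \<omega>-rule below a prefix: boxes commute with
  infinite conjunctions.\<close>

lemma holds_boxes_Star:
  assumes "kripke_model M" "u \<in> states M" "\<And>m. holds M u (boxes Qs ((Box P ^^ m) A))"
  shows "holds M u (boxes Qs (Box (Star P) A))"
  using assms(2,3)
proof (induction Qs arbitrary: u)
  case Nil
  have "holds M v A" if "(u, v) \<in> prog_rel M (Star P)" for v
    using that Nil prog_rel_Star[OF assms(1) Nil(1)]
    by (auto simp: holds_funpow_Box boxes_def simp del: prog_rel.simps)
  then show ?case by (simp add: boxes_def)
next
  case (Cons Q Qs)
  have "holds M v (boxes Qs (Box (Star P) A))" if "(u, v) \<in> prog_rel M Q" for v
    using that Cons.prems Cons.IH[of v] prog_rel_states[OF assms(1), of Q]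
    by (auto simp: boxes_def)
  then show ?case by (simp add: boxes_def)
qed

text \<open>Meant for \<open>Gen\<close>: the indices single out one boxed formula, and every entry
  with another formula carries a diamond.\<close>

lemma modal_index_unique:
  assumes "\<forall>(\<chi>, A) \<in> set xs. \<chi> \<in> {0, 1 :: nat}" "(\<Sum>(\<chi>, A) \<leftarrow> xs. \<chi>) = 1"
  obtains A where "(1, A) \<in> set xs" "\<And>B. (1, B) \<in> set xs \<Longrightarrow> B = A"
proof -
  have zero: "(1, B) \<notin> set ys" if "(\<Sum>(\<chi>, A) \<leftarrow> ys. \<chi>) = (0 :: nat)" for ys :: "(nat \<times> 'a) list" and B
    using that by fastforce
  have "\<exists>A. (1, A) \<in> set xs \<and> (\<forall>B. (1, B) \<in> set xs \<longrightarrow> B = A)"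
    using assms
  proof (induction xs)
    case (Cons x xs)
    obtain c C where x: "x = (c, C)" by force
    show ?case
    proof (cases "c = 1")
      case True
      then have "(\<Sum>(\<chi>, A) \<leftarrow> xs. \<chi>) = 0"
        using Cons.prems x by simp
      with True x zero show ?thesis by auto
    next
      case False
      then have "c = 0" using Cons.prems x by auto
      with Cons x show ?thesis by auto
    qed
  qed simp
  then show thesis using that by blast
qed

text \<open>The premises are assumed at all states and not only at \<open>u\<close>, because
  \<open>Gen\<close> evaluates its premise at a successor of \<open>u\<close>.\<close>

lemma inference_sound:
  assumes "inference S \<Gamma>" "kripke_model M"
    and "\<And>\<Delta> u. \<Delta> \<in> S \<Longrightarrow> u \<in> states M \<Longrightarrow> \<exists>A. A \<in># \<Delta> \<and> holds M u A"
    and "u \<in> states M"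
  shows "\<exists>A. A \<in># \<Gamma> \<and> holds M u A"
proof -
  have prem: "\<exists>A. A \<in># \<Delta> \<and> holds M u A" if "\<Delta> \<in> S" for \<Delta>
    using assms(3)[OF that assms(4)] .
  show ?thesis
    using assms(1)
  proof (cases rule: inference.cases)
    case (DiaStar Qs P m A \<Gamma>')
    have "holds M v (Dia (Star P) A)" if "v \<in> states M" "holds M v ((Dia P ^^ m) A)" for v
      using that prog_rel_Star[OF assms(2) that(1)]
      by (auto simp: holds_funpow_Dia simp del: prog_rel.simps)
    then have "holds M u (dias Qs ((Dia P ^^ m) A)) \<Longrightarrow> holds M u (dias Qs (Dia (Star P) A))"
      using holds_dias_mono[OF assms(2) _ assms(4)] by blast
    then show ?thesis
      using prem DiaStar by auto
  next
    case (BoxStar Qs P A \<Gamma>')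
    show ?thesis
    proof (rule ccontr)
      assume no: "\<not> ?thesis"
      have "holds M u (boxes Qs ((Box P ^^ m) A))" for m
      proof -
        have "{#boxes Qs ((Box P ^^ m) A)#} + \<Gamma>' \<in> S" using BoxStar by auto
        from prem[OF this] no BoxStar show ?thesis by auto
      qed
      then have "holds M u (boxes Qs (Box (Star P) A))"
        by (rule holds_boxes_Star[OF assms(2,4)])
      with no BoxStar show False by auto
    qed
  next
    case (Gen xs P \<Gamma>')
    obtain A where A: "(1, A) \<in> set xs" "\<And>B. (1, B) \<in> set xs \<Longrightarrow> B = A"
      using modal_index_unique[OF Gen(4,5)] by blast
    show ?thesis
    proof (cases "holds M u (Box P A)")
      case True
      moreover have "Box P A \<in># \<Gamma>"
        using A(1) Gen(2) by (force simp: modal_def)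
      ultimately show ?thesis by blast
    next
      case False
      then obtain v where v: "(u, v) \<in> prog_rel M P" "\<not> holds M v A" by auto
      then have "v \<in> states M" using prog_rel_states[OF assms(2)] by blast
      from assms(3)[OF _ this] Gen(1) obtain \<chi> B where B: "(\<chi>, B) \<in> set xs" "holds M v B"
        by force
      \<comment> \<open>\<open>B\<close> holds at \<open>v\<close> and the boxed formula
        \<open>A\<close> does not, so \<open>B\<close> must carry a diamond.\<close>
      have "\<chi> \<noteq> 1" using A(2) B v(2) by blast
      then have "Dia P B \<in># \<Gamma>"
        using B(1) Gen(2) by (force simp: modal_def)
      moreover have "holds M u (Dia P B)" using v B by auto
      ultimately show ?thesis by blast
    qed
  next
    case (Cut C \<Gamma>' \<Pi>)
    then show ?thesis using prem[of "{#C#} + \<Gamma>'"] prem[of "{#neg C#} + \<Pi>"] by auto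
  next
    case (AndR A \<Gamma>' B)
    then show ?thesis using prem[of "{#A#} + \<Gamma>'"] prem[of "{#B#} + \<Gamma>'"] by auto
  next
    case (BoxChoice P A \<Gamma>' R)
    then show ?thesis using prem[of "{#Box P A#} + \<Gamma>'"] prem[of "{#Box R A#} + \<Gamma>'"] by auto
  next
    case (Ax x \<Gamma>')
    then show ?thesis by (cases "u \<in> val M x") auto
  next
    case (OrR A B \<Gamma>')
    then show ?thesis using prem[of "{#A, B#} + \<Gamma>'"] by auto
  next
    case (DiaChoice P A R \<Gamma>')
    then show ?thesis using prem[of "{#Dia P A, Dia R A#} + \<Gamma>'"]
      by (auto simp: conj_disj_distribR ex_disj_distrib)
  next
    case (DiaComp P R A \<Gamma>')
    then show ?thesis using prem[of "{#Dia P (Dia R A)#} + \<Gamma>'"]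
      by (auto simp: conj_disj_distribR ex_disj_distrib)
  next
    case (BoxComp P R A \<Gamma>')
    then show ?thesis using prem[of "{#Box P (Box R A)#} + \<Gamma>'"]
      by (auto simp: conj_disj_distribR ex_disj_distrib)
  qed
qed

theorem soundness:
  assumes "derivable \<Gamma>"
  shows "seq_valid TYPE('s) \<Gamma>"
proof -
  have "\<exists>A. A \<in># \<Gamma> \<and> holds M u A" if "kripke_model M" "u \<in> states M" for M :: "'s kripke" and u
    using assms that(2)
  proof (induction arbitrary: u rule: derivable.induct)
    case (1 S \<Gamma>)
    then show ?case using inference_sound[OF 1(1) that(1)] by blast
  qed
  then show ?thesis by (auto simp: seq_valid_def)
qed

lemma derivable_ord_derivable: "derivable_ord \<alpha> \<Gamma> \<Longrightarrow> derivable \<Gamma>"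
  by (induction rule: derivable_ord.induct) (meson derivable.intros)

lemma not_seq_valid_empty: "\<not> seq_valid TYPE('s) {#}"
proof -
  have "kripke_model \<lparr>states = UNIV :: 's set, rel = \<lambda>_. {}, val = \<lambda>_. {}\<rparr>"
    by (simp add: kripke_model_def)
  then show ?thesis unfolding seq_valid_def by fastforce
qed

section \<open>Derivations below \<open>\<omega> \<cdot> (i + 1)\<close>\<close>

definition derivable_level :: "nat \<Rightarrow> sequent \<Rightarrow> bool" where
  "derivable_level i \<Gamma> \<longleftrightarrow> (\<exists>k :: nat. derivable_ord (i, k) \<Gamma>)"

text \<open>Finitely many offsets are bounded by their sum, whose successor can label the
  conclusion. Finitary rules thus never leave a level.\<close>

lemma derivable_level_inference:
  assumes "inference S \<Gamma>" "finite S" "\<And>\<Delta>. \<Delta> \<in> S \<Longrightarrow> derivable_level i \<Delta>"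
  shows "derivable_level i \<Gamma>"
proof -
  obtain k where k: "\<And>\<Delta>. \<Delta> \<in> S \<Longrightarrow> derivable_ord (i, k \<Delta> :: nat) \<Delta>"
    using assms(3) unfolding derivable_level_def by metis
  have "\<exists>\<beta> < (i, Suc (\<Sum>\<Delta>\<in>S. k \<Delta>)). derivable_ord \<beta> \<Delta>" if "\<Delta> \<in> S" for \<Delta>
    using k[OF that] member_le_sum[OF that, of k] assms(2)
    by (intro exI[of _ "(i, k \<Delta>)"]) auto
  then show ?thesis
    unfolding derivable_level_def using derivable_ord.intros[OF assms(1)] by blast
qed

text \<open>The labels \<open>(0, k)\<close> of the premises may be unbounded in \<open>k\<close>,
  but all of them lie below \<open>(1, 0)\<close>.\<close>

lemma derivable_level_BoxStar:
  assumes "\<And>m. derivable_level 0 ({#boxes Qs ((Box P ^^ m) A)#} + \<Gamma>)"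
  shows "derivable_level 1 ({#boxes Qs (Box (Star P) A)#} + \<Gamma>)"
proof -
  have "derivable_ord (1 :: nat, 0 :: nat) ({#boxes Qs (Box (Star P) A)#} + \<Gamma>)"
    using assms unfolding derivable_level_def
    by (intro derivable_ord.intros[OF inference.BoxStar]) fastforce
  then show ?thesis unfolding derivable_level_def by blast
qed

text \<open>Fixing which formula gets the index 1 frees all later uses of \<open>Gen\<close> from
  indices.\<close>

lemma derivable_level_Gen:
  assumes "derivable_level i ({#A#} + \<Delta>)"
  shows "derivable_level i ({#Box P A#} + image_mset (Dia P) \<Delta> + \<Gamma>)"
proof -
  obtain ds where ds: "mset ds = \<Delta>" using ex_mset by blast
  let ?xs = "(1 :: nat, A) # map (Pair 0) ds"
  have sum: "(\<Sum>(\<chi>, A) \<leftarrow> map (Pair (0 :: nat)) ds. \<chi>) = 0"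
    by (induction ds) auto
  have "inference {mset (map snd ?xs)} (mset (map (\<lambda>(\<chi>, A). modal \<chi> P A) ?xs) + \<Gamma>)"
    by (rule inference.Gen) (use sum in auto)
  moreover have "mset (map snd ?xs) = {#A#} + \<Delta>"
    using ds by (simp add: comp_def)
  moreover have "mset (map (\<lambda>(\<chi>, A). modal \<chi> P A) ?xs) = {#Box P A#} + image_mset (Dia P) \<Delta>"
    using ds by (auto simp: modal_def comp_def)
  ultimately have "inference {{#A#} + \<Delta>} ({#Box P A#} + image_mset (Dia P) \<Delta> + \<Gamma>)"
    by metis
  then show ?thesis by (rule derivable_level_inference) (use assms in auto)
qed

lemma derivable_level_identity: "derivable_level i ({#A, neg A#} + \<Gamma>)"
proof -
  \<comment> \<open>\<open>A'\<close> and \<open>B'\<close> are variables of their own so that the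
    cases of \<open>Or\<close> and \<open>And\<close> are both instances, with a formula and its
    negation exchanged.\<close>
  have conj: "derivable_level i ({#Or A B, And A' B'#} + \<Gamma>)"
    if "\<And>\<Gamma>. derivable_level i ({#A, A'#} + \<Gamma>)" "\<And>\<Gamma>. derivable_level i ({#B, B'#} + \<Gamma>)" for A B A' B' \<Gamma>
  proof -
    have "derivable_level i ({#A'#} + ({#Or A B#} + \<Gamma>))"
      using derivable_level_inference[OF inference.OrR[of A B "{#A'#} + \<Gamma>"], of i]
        that(1)[of "{#B#} + \<Gamma>"] by (simp add: add_mset_commute)
    moreover have "derivable_level i ({#B'#} + ({#Or A B#} + \<Gamma>))"
      using derivable_level_inference[OF inference.OrR[of A B "{#B'#} + \<Gamma>"], of i]
        that(2)[of "{#A#} + \<Gamma>"] by (simp add: add_mset_commute)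
    ultimately show ?thesis
      using derivable_level_inference[OF inference.AndR[of A' "{#Or A B#} + \<Gamma>" B'], of i]
      by (auto simp: add_mset_commute)
  qed
  have lit: "derivable_level i ({#Pos x, Neg x#} + \<Gamma>)" for x \<Gamma>
    by (rule derivable_level_inference[OF inference.Ax]) auto
  show ?thesis
  proof (induction A arbitrary: \<Gamma>)
    case (Pos x)
    then show ?case using lit[of x] by simp
  next
    case (Neg x)
    then show ?case using lit[of x] by (simp add: add_mset_commute)
  next
    case (Or A B)
    then show ?case using conj[of A "neg A" B "neg B"] by simp
  next
    case (And A B)
    then show ?case using conj[of "neg A" A "neg B" B] by (simp add: add_mset_commute)
  next
    case (Box P A)
    then show ?case
      using derivable_level_Gen[of i A "{#neg A#}" P \<Gamma>] Box[of "{#}"]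
      by (simp add: add_mset_commute)
  next
    case (Dia P A)
    then show ?case
      using derivable_level_Gen[of i "neg A" "{#A#}" P \<Gamma>] Dia[of "{#}"]
      by (simp add: add_mset_commute)
  qed
qed

section \<open>Admissible structural rules\<close>

lemma derivable_level_cut:
  "derivable_level i ({#C#} + \<Gamma>) \<Longrightarrow> derivable_level i ({#neg C#} + \<Pi>) \<Longrightarrow> derivable_level i (\<Gamma> + \<Pi>)"
  by (rule derivable_level_inference[OF inference.Cut[of C \<Gamma> \<Pi>]]) auto

text \<open>A derivable sequent is nonempty by soundness. One of its formulas \<open>C\<close> is
  cut against an identity on \<open>C\<close> whose context brings in \<open>\<Delta>\<close>, and
  which restores \<open>C\<close>.\<close>

lemma derivable_level_weaken:
  assumes "derivable_level i \<Gamma>"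
  shows "derivable_level i (\<Gamma> + \<Delta>)"
proof -
  have "derivable \<Gamma>"
    using assms derivable_ord_derivable unfolding derivable_level_def by blast
  then have "\<Gamma> \<noteq> {#}"
    using soundness[where 's = nat] not_seq_valid_empty by blast
  then obtain C \<Gamma>' where \<Gamma>: "\<Gamma> = {#C#} + \<Gamma>'"
    by (metis multiset_cases add_mset_add_single union_commute)
  have "derivable_level i ({#neg C#} + ({#C#} + \<Delta>))"
    using derivable_level_identity[of i C \<Delta>] by (simp add: add_mset_commute)
  from derivable_level_cut[OF _ this, of \<Gamma>'] assms \<Gamma> show ?thesis by simp
qed

text \<open>Contraction is not a rule of the calculus; a cut on \<open>A \<or> A\<close> simulates it.\<close>

lemma derivable_level_contract:
  assumes "derivable_level i ({#A, A#} + \<Gamma>)"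
  shows "derivable_level i ({#A#} + \<Gamma>)"
proof -
  have 1: "derivable_level i ({#Or A A#} + \<Gamma>)"
    by (rule derivable_level_inference[OF inference.OrR]) (use assms in auto)
  have "derivable_level i ({#neg A#} + {#A#})"
    using derivable_level_identity[of i A "{#}"] by (simp add: add_mset_commute)
  then have "derivable_level i ({#And (neg A) (neg A)#} + {#A#})"
    using derivable_level_inference[OF inference.AndR[of "neg A" "{#A#}" "neg A"], of i] by auto
  then have "derivable_level i ({#neg (Or A A)#} + {#A#})" by simp
  from derivable_level_cut[OF 1 this] show ?thesis by simp
qed

text \<open>After weakening to \<open>\<Gamma> + \<Delta>\<close>, each member of
  \<open>\<Gamma>\<close> is contracted into an equal member of \<open>\<Delta>\<close>.\<close>

lemma derivable_level_structural:
  assumes "derivable_level i \<Gamma>" "set_mset \<Gamma> \<subseteq> set_mset \<Delta>"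
  shows "derivable_level i \<Delta>"
proof -
  have "derivable_level i (\<Gamma> + \<Delta>) \<Longrightarrow> derivable_level i \<Delta>"
    using assms(2)
  proof (induction \<Gamma>)
    case (add A \<Gamma>)
    obtain \<Delta>' where \<Delta>': "\<Delta> = add_mset A \<Delta>'"
      using add.prems(2) by (auto dest: multi_member_split)
    have "derivable_level i ({#A#} + (\<Gamma> + \<Delta>'))"
      by (rule derivable_level_contract) (use add.prems(1) \<Delta>' in simp)
    then show ?case using add \<Delta>' by simp
  qed simp
  then show ?thesis using derivable_level_weaken[OF assms(1)] by blast
qed

section \<open>Sequents as sets\<close>

text \<open>Sets absorb weakening and contraction, so premises with different contexts can be merged
  by monotonicity.\<close>

definition prov :: "nat \<Rightarrow> form set \<Rightarrow> bool" where
  "prov i X \<longleftrightarrow> (\<exists>\<Gamma>. set_mset \<Gamma> \<subseteq> X \<and> derivable_level i \<Gamma>)"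

lemma prov_mono: "prov i X \<Longrightarrow> X \<subseteq> Y \<Longrightarrow> prov i Y"
  unfolding prov_def by blast

lemma prov_set_mset: "prov i (set_mset \<Gamma>) \<longleftrightarrow> derivable_level i \<Gamma>"
  unfolding prov_def by (metis derivable_level_structural order_refl)

text \<open>The context \<open>\<Delta>\<close> stays open so that two premises can later be given
  the same one.\<close>

lemma prov_E:
  assumes "prov i (set_mset \<Theta> \<union> X)"
  obtains \<Gamma> where "set_mset \<Gamma> \<subseteq> X"
    "\<And>\<Delta>. set_mset \<Gamma> \<subseteq> set_mset \<Delta> \<Longrightarrow> derivable_level i (\<Theta> + \<Delta>)"
proof -
  from assms obtain \<Gamma>0 where \<Gamma>0: "set_mset \<Gamma>0 \<subseteq> set_mset \<Theta> \<union> X" "derivable_level i \<Gamma>0"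
    unfolding prov_def by blast
  show thesis
  proof (rule that[of "filter_mset (\<lambda>A. A \<in> X) \<Gamma>0"])
    fix \<Delta> assume "set_mset (filter_mset (\<lambda>A. A \<in> X) \<Gamma>0) \<subseteq> set_mset \<Delta>"
    then show "derivable_level i (\<Theta> + \<Delta>)"
      using \<Gamma>0 by (intro derivable_level_structural[OF \<Gamma>0(2)]) auto
  qed auto
qed

lemma prov_insertE:
  assumes "prov i (insert A X)"
  obtains \<Gamma> where "set_mset \<Gamma> \<subseteq> X" "derivable_level i ({#A#} + \<Gamma>)"
proof -
  have "prov i (set_mset {#A#} \<union> X)" using assms by simp
  from prov_E[OF this] that show thesis by (metis order_refl)
qed

lemma prov_rule1:
  assumes "\<And>\<Gamma>. inference {\<Theta> + \<Gamma>} ({#C#} + \<Gamma>)" "prov i (set_mset \<Theta> \<union> X)"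
  shows "prov i (insert C X)"
proof -
  obtain \<Gamma> where \<Gamma>: "set_mset \<Gamma> \<subseteq> X" "derivable_level i (\<Theta> + \<Gamma>)"
    using prov_E[OF assms(2)] by (metis order_refl)
  have "derivable_level i ({#C#} + \<Gamma>)"
    by (rule derivable_level_inference[OF assms(1)]) (use \<Gamma> in auto)
  with \<Gamma>(1) show ?thesis unfolding prov_def by (intro exI[of _ "{#C#} + \<Gamma>"]) auto
qed

lemma prov_rule2:
  assumes "\<And>\<Gamma>. inference {{#A#} + \<Gamma>, {#B#} + \<Gamma>} ({#C#} + \<Gamma>)"
    and "prov i (insert A X)" "prov i (insert B X)"
  shows "prov i (insert C X)"
proof -
  obtain \<Gamma> where \<Gamma>: "set_mset \<Gamma> \<subseteq> X"
    "\<And>\<Delta>. set_mset \<Gamma> \<subseteq> set_mset \<Delta> \<Longrightarrow> derivable_level i ({#A#} + \<Delta>)"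
    using prov_E[of i "{#A#}" X] assms(2) by auto
  obtain \<Pi> where \<Pi>: "set_mset \<Pi> \<subseteq> X"
    "\<And>\<Delta>. set_mset \<Pi> \<subseteq> set_mset \<Delta> \<Longrightarrow> derivable_level i ({#B#} + \<Delta>)"
    using prov_E[of i "{#B#}" X] assms(3) by auto
  have "derivable_level i ({#C#} + (\<Gamma> + \<Pi>))"
    by (rule derivable_level_inference[OF assms(1)]) (use \<Gamma>(2)[of "\<Gamma> + \<Pi>"] \<Pi>(2)[of "\<Gamma> + \<Pi>"] in auto)
  with \<Gamma>(1) \<Pi>(1) show ?thesis unfolding prov_def by (intro exI[of _ "{#C#} + (\<Gamma> + \<Pi>)"]) auto
qed

lemma prov_cut:
  assumes "prov i (insert C X)" "prov i (insert (neg C) X)"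
  shows "prov i X"
proof -
  obtain \<Gamma> where \<Gamma>: "set_mset \<Gamma> \<subseteq> X" "derivable_level i ({#C#} + \<Gamma>)"
    using prov_insertE[OF assms(1)] .
  obtain \<Pi> where \<Pi>: "set_mset \<Pi> \<subseteq> X" "derivable_level i ({#neg C#} + \<Pi>)"
    using prov_insertE[OF assms(2)] .
  show ?thesis
    unfolding prov_def using derivable_level_cut[OF \<Gamma>(2) \<Pi>(2)] \<Gamma>(1) \<Pi>(1)
    by (intro exI[of _ "\<Gamma> + \<Pi>"]) auto
qed

lemma prov_identity: "A \<in> X \<Longrightarrow> neg A \<in> X \<Longrightarrow> prov i X"
  unfolding prov_def using derivable_level_identity[of i A "{#}"]
  by (intro exI[of _ "{#A, neg A#}"]) auto

section \<open>The rules of the calculus for sets\<close>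

lemma prov_Or: "prov i ({A, B} \<union> X) \<Longrightarrow> prov i (insert (Or A B) X)"
  using prov_rule1[OF inference.OrR, of i A B X] by simp

lemma prov_And: "prov i (insert A X) \<Longrightarrow> prov i (insert B X) \<Longrightarrow> prov i (insert (And A B) X)"
  using prov_rule2[OF inference.AndR] .

lemma prov_BoxChoice:
  "prov i (insert (Box P A) X) \<Longrightarrow> prov i (insert (Box R A) X) \<Longrightarrow> prov i (insert (Box (Choice P R) A) X)"
  using prov_rule2[OF inference.BoxChoice] .

lemma prov_DiaChoice:
  "prov i ({Dia P A, Dia R A} \<union> X) \<Longrightarrow> prov i (insert (Dia (Choice P R) A) X)"
  using prov_rule1[OF inference.DiaChoice, of i P A R X] by simp

lemma prov_BoxComp: "prov i (insert (Box P (Box R A)) X) \<Longrightarrow> prov i (insert (Box (Comp P R) A) X)"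
  using prov_rule1[OF inference.BoxComp, of i P R A X] by simp

lemma prov_DiaComp: "prov i (insert (Dia P (Dia R A)) X) \<Longrightarrow> prov i (insert (Dia (Comp P R) A) X)"
  using prov_rule1[OF inference.DiaComp, of i P R A X] by simp

text \<open>The rule keeps its principal formula. Read upwards, it adds any unfolding of a starred
  diamond already in \<open>X\<close>.\<close>

lemma prov_DiaStar:
  assumes "prov i (insert (dias Qs ((Dia P ^^ m) A)) X)" "dias Qs (Dia (Star P) A) \<in> X"
  shows "prov i X"
proof -
  have "prov i (insert (dias Qs (Dia (Star P) A)) X)"
    by (rule prov_rule1[OF inference.DiaStar[of Qs m P A]]) (use assms in \<open>auto elim: prov_mono\<close>)
  with assms(2) show ?thesis by (simp add: insert_absorb)
qed

lemma prov_Gen: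
  assumes "prov i (insert A X)"
  shows "prov i (insert (Box P A) (Dia P ` X))"
proof -
  obtain \<Gamma> where \<Gamma>: "set_mset \<Gamma> \<subseteq> X" "derivable_level i ({#A#} + \<Gamma>)"
    using prov_insertE[OF assms] .
  show ?thesis
    unfolding prov_def using derivable_level_Gen[OF \<Gamma>(2), of P "{#}"] \<Gamma>(1)
    by (intro exI[of _ "{#Box P A#} + image_mset (Dia P) \<Gamma>"]) auto
qed

text \<open>Each premise may draw on a different finite part of \<open>X\<close>; as
  \<open>X\<close> is finite, the whole of it serves as their common context.\<close>

lemma prov_BoxStar:
  assumes "\<And>m. prov 0 (insert (boxes Qs ((Box P ^^ m) A)) X)" "finite X"
  shows "prov 1 (insert (boxes Qs (Box (Star P) A)) X)"
proof -
  have "derivable_level 0 ({#boxes Qs ((Box P ^^ m) A)#} + mset_set X)" for m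
    unfolding prov_set_mset[symmetric] using assms by simp
  from derivable_level_BoxStar[OF this] show ?thesis
    unfolding prov_set_mset[symmetric] using assms(2) by simp
qed

lemma prov_Gen_funpow:
  assumes "prov i (insert A X)"
  shows "prov i (insert ((Box P ^^ m) A) ((Dia P ^^ m) ` X))"
proof (induction m)
  case (Suc m)
  from prov_Gen[OF this, of P] show ?case by (simp add: image_comp)
qed (use assms in simp)

section \<open>Fixpoint and induction axioms\<close>

lemma prov_Star_reflexive: "prov i {Dia (Star P) A, neg A}"
proof (rule prov_DiaStar[of _ "[]" 0 P A])
  show "prov i (insert (dias [] ((Dia P ^^ 0) A)) {Dia (Star P) A, neg A})"
    by (rule prov_identity[of A]) (auto simp: dias_def)
qed (simp add: dias_def)

text \<open>The \<omega>-rule is applied below the prefix \<open>[P]\<close>. Its premise number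
  \<open>m\<close> contains \<open>m + 1\<close> boxes and is an identity with the unfolding
  \<open>Suc m\<close> of the diamond.\<close>

lemma prov_Star_step: "prov 1 {Dia (Star P) A, Box P (Box (Star P) (neg A))}"
proof -
  have "prov 0 (insert (boxes [P] ((Box P ^^ m) (neg A))) {Dia (Star P) A})" for m
  proof (rule prov_DiaStar[of _ "[]" "Suc m" P A])
    show "prov 0 (insert (dias [] ((Dia P ^^ Suc m) A))
      (insert (boxes [P] ((Box P ^^ m) (neg A))) {Dia (Star P) A}))"
      by (rule prov_identity[of "(Dia P ^^ Suc m) A"]) (auto simp: dias_def boxes_def neg_funpow_Dia)
  qed (simp add: dias_def)
  from prov_BoxStar[OF this] show ?thesis
    by (simp add: boxes_def insert_commute)
qed

text \<open>Each premise of the \<omega>-rule is proved by induction on \<open>m\<close>: one use of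
  the hypothesis, lifted through \<open>m\<close> applications of \<open>Gen\<close>, leads from
  \<open>m\<close> boxes to \<open>m + 1\<close>. So all premises have finite derivations.\<close>

lemma prov_Star_induction_axiom:
  "prov 1 {Dia (Star P) (And A (Dia P (neg A))), neg A, Box (Star P) A}"
proof -
  let ?D = "And A (Dia P (neg A))" and ?X = "{Dia (Star P) (And A (Dia P (neg A))), neg A}"
  \<comment> \<open>Modus ponens: \<open>?D\<close> is the negation of the implication from
    \<open>A\<close> to \<open>Box P A\<close>.\<close>
  have D: "prov 0 {Box P A, neg A, ?D}"
  proof -
    have "prov 0 (insert A {Box P A, neg A})" "prov 0 (insert (Dia P (neg A)) {Box P A, neg A})"
      by (rule prov_identity[of A]; simp) (rule prov_identity[of "Box P A"]; simp)
    from prov_And[OF this] show ?thesis by (simp add: insert_commute)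
  qed
  have "prov 0 (insert ((Box P ^^ m) A) ?X)" for m
  proof (induction m)
    case 0
    show ?case by (rule prov_identity[of A]) auto
  next
    case (Suc m)
    have "prov 0 (insert ((Box P ^^ m) (Box P A)) ((Dia P ^^ m) ` {neg A, ?D}))"
      by (rule prov_Gen_funpow[OF D])
    then have 1: "prov 0 {(Box P ^^ Suc m) A, neg ((Box P ^^ m) A), (Dia P ^^ m) ?D}"
      by (simp add: neg_funpow_Box funpow_swap1)
    let ?Y = "insert ((Dia P ^^ m) ?D) (insert ((Box P ^^ Suc m) A) ?X)"
    have "prov 0 ?Y"
    proof (rule prov_cut)
      show "prov 0 (insert ((Box P ^^ m) A) ?Y)" by (rule prov_mono[OF Suc]) auto
      show "prov 0 (insert (neg ((Box P ^^ m) A)) ?Y)" by (rule prov_mono[OF 1]) auto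
    qed
    then have "prov 0 (insert (dias [] ((Dia P ^^ m) ?D)) (insert ((Box P ^^ Suc m) A) ?X))"
      by (simp add: dias_def)
    then show ?case by (rule prov_DiaStar) (simp add: dias_def)
  qed
  then have "prov 0 (insert (boxes [] ((Box P ^^ m) A)) ?X)" for m
    by (simp add: boxes_def)
  from prov_BoxStar[OF this] show ?thesis by (simp add: boxes_def insert_commute)
qed

lemma prov_cut_sets:
  assumes "prov i (insert C X)" "prov i (insert (neg C) Y)" "X \<subseteq> Z" "Y \<subseteq> Z"
  shows "prov i Z"
  by (rule prov_cut[of i C]; rule prov_mono, rule assms(1,2), use assms(3,4) in auto)

text \<open>The loop invariant rule: the step is necessitated by \<open>Gen\<close> with empty
  context and cut with the induction axiom; \<open>init\<close> and \<open>post\<close> are then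
  attached by cuts.\<close>

lemma prov_invariant:
  assumes step: "prov 1 {neg I, Box P I}" and init: "prov 1 (insert I X)" and post: "prov 1 {neg I, B}"
  shows "prov 1 (insert (Box (Star P) B) X)"
proof -
  have "prov 1 (insert (Or (neg I) (Box P I)) {})"
    using step by (intro prov_Or) simp
  from prov_Gen[OF this, of "Star P"]
  have 1: "prov 1 (insert (neg (Dia (Star P) (And I (Dia P (neg I))))) {})" by simp
  have 2: "prov 1 (insert (Box (Star P) I) {neg I})"
    by (rule prov_cut_sets[OF _ 1, of "{neg I, Box (Star P) I}"])
      (use prov_Star_induction_axiom[of P I] in \<open>auto simp: insert_commute\<close>)
  have "prov 1 (insert (Box (Star P) B) {Dia (Star P) (neg I)})"
    using prov_Gen[of 1 B "{neg I}" "Star P"] post by (simp add: insert_commute)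
  then have "prov 1 (insert (neg (Box (Star P) I)) {Box (Star P) B})"
    by (simp add: insert_commute)
  from prov_cut_sets[OF 2 this] have "prov 1 (insert (neg I) {Box (Star P) B})" by auto
  from prov_cut_sets[OF init this] show ?thesis by auto
qed

section \<open>Finite disjunctions\<close>

text \<open>The final conjunction is a contradiction and plays falsum, so the empty disjunction is
  false. The order of the disjuncts is arbitrary; later arguments use only the next two
  lemmas.\<close>

definition Disj :: "form set \<Rightarrow> form" where
  "Disj X = foldr Or (SOME xs. set xs = X) (And (Pos 0) (Neg 0))"

lemma prov_Disj_intro:
  assumes "finite X" "prov i (X \<union> Y)"
  shows "prov i (insert (Disj X) Y)"
proof -
  have *: "prov i (set xs \<union> Y) \<Longrightarrow> prov i (insert (foldr Or xs (And (Pos 0) (Neg 0))) Y)" for xs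
  proof (induction xs arbitrary: Y)
    case Nil
    then show ?case by (auto elim: prov_mono)
  next
    case (Cons A xs)
    have "prov i (set xs \<union> insert A Y)" using Cons.prems by simp
    from Cons.IH[OF this] show ?case
      by (auto intro!: prov_Or simp: insert_commute)
  qed
  have "set (SOME xs. set xs = X) = X"
    using someI_ex[OF finite_list[OF assms(1)]] .
  with *[of "SOME xs. set xs = X"] assms(2) show ?thesis by (simp add: Disj_def)
qed

lemma prov_neg_Disj_intro:
  assumes "finite X" "\<And>A. A \<in> X \<Longrightarrow> prov i (insert (neg A) Y)"
  shows "prov i (insert (neg (Disj X)) Y)"
proof -
  have *: "(\<And>A. A \<in> set xs \<Longrightarrow> prov i (insert (neg A) Y)) \<Longrightarrow>
    prov i (insert (neg (foldr Or xs (And (Pos 0) (Neg 0)))) Y)" for xs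
  proof (induction xs)
    case Nil
    show ?case by (auto intro!: prov_Or prov_identity[of "Pos 0"])
  next
    case (Cons A xs)
    then show ?case by (auto intro!: prov_And)
  qed
  have "set (SOME xs. set xs = X) = X"
    using someI_ex[OF finite_list[OF assms(1)]] .
  with *[of "SOME xs. set xs = X"] assms(2) show ?thesis by (simp add: Disj_def)
qed

lemma prov_neg_Disj_member:
  assumes "finite X" "X \<subseteq> Y"
  shows "prov i (insert (neg (Disj X)) Y)"
  using assms by (intro prov_neg_Disj_intro) (auto intro: prov_identity)

text \<open>Case distinction on \<open>C\<close>, by a cut: if both enlarged disjunctions hold, the
  disjunct \<open>C\<close> or \<open>neg C\<close> fails in one of them.\<close>

lemma prov_Disj_insert_neg:
  assumes "finite X"
  shows "prov i {neg (Disj (insert C X)), neg (Disj (insert (neg C) X)), Disj X}"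
proof -
  let ?Y = "{neg (Disj (insert C X)), neg (Disj (insert (neg C) X))}"
  have "prov i (insert C (?Y \<union> X))"
    by (rule prov_mono[OF prov_neg_Disj_member[of "insert C X" "insert C X"]]) (use assms in auto)
  moreover have "prov i (insert (neg C) (?Y \<union> X))"
    by (rule prov_mono[OF prov_neg_Disj_member[of "insert (neg C) X" "insert (neg C) X"]]) (use assms in auto)
  ultimately have "prov i (X \<union> ?Y)"
    using prov_cut by (metis Un_commute)
  from prov_Disj_intro[OF assms this] show ?thesis by (simp add: insert_commute)
qed

section \<open>The Fischer--Ladner closure\<close>

fun fl_step :: "form \<Rightarrow> form set" where
  "fl_step (Or A B) = {A, B}"
| "fl_step (And A B) = {A, B}"
| "fl_step (Dia (PVar a) A) = {A}"
| "fl_step (Dia (Comp P R) A) = {Dia P (Dia R A)}"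
| "fl_step (Dia (Choice P R) A) = {Dia P A, Dia R A}"
| "fl_step (Dia (Star P) A) = {A, Dia P (Dia (Star P) A)}"
| "fl_step (Box (PVar a) A) = {A}"
| "fl_step (Box (Comp P R) A) = {Box P (Box R A)}"
| "fl_step (Box (Choice P R) A) = {Box P A, Box R A}"
| "fl_step (Box (Star P) A) = {A, Box P (Box (Star P) A)}"
| "fl_step _ = {}"

lemma fl_step_neg: "fl_step (neg A) = neg ` fl_step A"
  by (induction A rule: fl_step.induct) auto

text \<open>Unwinding a star produces a larger formula, so the closure is built by recursion on the
  program, with the body left unanalysed. Finiteness is then immediate. \<open>M\<close> stands for
  \<open>Box\<close> or \<open>Dia\<close>.\<close>

primrec fl_modal :: "(prog \<Rightarrow> form \<Rightarrow> form) \<Rightarrow> prog \<Rightarrow> form \<Rightarrow> form set" where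
  "fl_modal M (PVar a) A = {M (PVar a) A}"
| "fl_modal M (Comp P R) A = {M (Comp P R) A} \<union> fl_modal M P (M R A) \<union> fl_modal M R A"
| "fl_modal M (Choice P R) A = {M (Choice P R) A} \<union> fl_modal M P A \<union> fl_modal M R A"
| "fl_modal M (Star P) A = {M (Star P) A} \<union> fl_modal M P (M (Star P) A)"

lemma fl_modal_self: "M P A \<in> fl_modal M P A"
  by (cases P) auto

lemma finite_fl_modal: "finite (fl_modal M P A)"
  by (induction P arbitrary: A) auto

text \<open>Steps leave the set only towards the body \<open>A\<close>. For a star, the body of the
  inner program is the starred formula itself, which is already a member.\<close>

lemma fl_step_fl_modal:
  assumes "M \<in> {Box, Dia}" "B \<in> fl_modal M P A"
  shows "fl_step B \<subseteq> insert A (fl_modal M P A)"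
  using assms(2)
proof (induction P arbitrary: A B)
  case (PVar a)
  then show ?case using assms(1) by auto
next
  case (Comp P R)
  then show ?case using assms(1) fl_modal_self[of M P "M R A"] fl_modal_self[of M R A] by fastforce
next
  case (Choice P R)
  then show ?case using assms(1) fl_modal_self[of M P A] fl_modal_self[of M R A] by fastforce
next
  case (Star P)
  then show ?case using assms(1) fl_modal_self[of M P "M (Star P) A"] by fastforce
qed

primrec fl :: "form \<Rightarrow> form set" where
  "fl (Pos x) = {Pos x}"
| "fl (Neg x) = {Neg x}"
| "fl (Or A B) = {Or A B} \<union> fl A \<union> fl B"
| "fl (And A B) = {And A B} \<union> fl A \<union> fl B"
| "fl (Box P A) = fl_modal Box P A \<union> fl A"
| "fl (Dia P A) = fl_modal Dia P A \<union> fl A"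

lemma fl_self: "A \<in> fl A"
  by (cases A) (auto simp: fl_modal_self)

lemma finite_fl: "finite (fl A)"
  by (induction A) (auto simp: finite_fl_modal)

lemma fl_step_fl: "B \<in> fl A \<Longrightarrow> fl_step B \<subseteq> fl A"
proof (induction A arbitrary: B)
  case (Box P A)
  then show ?case using fl_step_fl_modal[of Box B P A] fl_self[of A] by auto
next
  case (Dia P A)
  then show ?case using fl_step_fl_modal[of Dia B P A] fl_self[of A] by auto
qed (use fl_self in auto)

section \<open>The canonical model over a finite closed set\<close>

locale fl_closed =
  fixes Cl :: "form set"
  assumes finite_Cl: "finite Cl"
    and neg_Cl: "A \<in> Cl \<Longrightarrow> neg A \<in> Cl"
    and fl_step_Cl: "A \<in> Cl \<Longrightarrow> fl_step A \<subseteq> Cl"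
begin

text \<open>A state is the set of the formulas of the closure that are false in it.\<close>

definition St :: "form set set" where
  "St = {u. u \<subseteq> Cl \<and> \<not> prov 1 u \<and> (\<forall>A \<in> Cl. A \<in> u \<or> neg A \<in> u)}"

lemma finite_St: "finite St"
  unfolding St_def by (rule finite_subset[of _ "Pow Cl"]) (use finite_Cl in auto)

lemma finite_state: "u \<in> St \<Longrightarrow> finite u"
  unfolding St_def using finite_Cl finite_subset by blast

lemma state_memberI: "u \<in> St \<Longrightarrow> A \<in> Cl \<Longrightarrow> \<not> prov 1 (insert A u) \<Longrightarrow> A \<in> u"
  unfolding St_def using prov_identity[of A "insert A u"] by auto

text \<open>Induction over the tree that splits \<open>X\<close> on undecided formulas of
  \<open>Cl\<close>. Its leaves are provable sets or states, and it is finite because each split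
  shrinks \<open>Cl - X\<close>.\<close>

lemma state_induct [consumes 1, case_names prov split state]:
  assumes "X \<subseteq> Cl"
    and prov: "\<And>X. X \<subseteq> Cl \<Longrightarrow> prov 1 X \<Longrightarrow> T X"
    and split: "\<And>X C. X \<subseteq> Cl \<Longrightarrow> T (insert C X) \<Longrightarrow> T (insert (neg C) X) \<Longrightarrow> T X"
    and state: "\<And>v. v \<in> St \<Longrightarrow> T v"
  shows "T X"
  using assms(1)
proof (induction "card (Cl - X)" arbitrary: X rule: less_induct)
  case less
  consider "prov 1 X" | "X \<in> St" | C where "\<not> prov 1 X" "C \<in> Cl" "C \<notin> X" "neg C \<notin> X"
    using less.prems unfolding St_def by blast
  then show ?case
  proof cases
    case (3 C)
    have "T (insert D X)" if "D \<in> Cl" "D \<notin> X" for D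
    proof (rule less.hyps)
      show "card (Cl - insert D X) < card (Cl - X)"
        using that finite_Cl by (intro psubset_card_mono) auto
    qed (use that less.prems in auto)
    then show ?thesis using 3 neg_Cl split[OF less.prems] by blast
  qed (use less.prems prov state in auto)
qed

lemma state_extension:
  assumes "X \<subseteq> Cl" "\<not> prov 1 X"
  obtains v where "v \<in> St" "X \<subseteq> v"
proof -
  have "prov 1 X \<or> (\<exists>v \<in> St. X \<subseteq> v)"
    using assms(1)
    by (induction rule: state_induct) (auto dest: prov_cut)
  with assms(2) that show thesis by blast
qed

text \<open>
  The usual canonical accessibility, that \<open>u\<close> is consistent with \<open>\<langle>P\<rangle>v\<close>, dualised. It is imposed on
  atomic programs only; for other programs it is contained in the relation of the model
  (\<open>acc_prog_rel\<close>), and the converse inclusion is replaced by \<open>Dia_prog_rel\<close>.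
\<close>

definition acc :: "prog \<Rightarrow> form set \<Rightarrow> form set \<Rightarrow> bool" where
  "acc P u v \<longleftrightarrow> \<not> prov 1 (insert (Box P (Disj v)) u)"

text \<open>Otherwise \<open>Box P (Or (Disj X) B)\<close> would be provable from \<open>u\<close>
  for all \<open>X\<close> in the closure, by \<open>state_induct\<close>; the empty
  \<open>X\<close> then contradicts the assumption.\<close>

lemma acc_exists:
  assumes "\<not> prov 1 (insert (Box P B) u)"
  obtains v where "v \<in> St" "acc P u v" "\<not> prov 1 (insert B v)"
proof -
  have "prov 1 (insert (Box P (Or (Disj X) B)) u)"
    if none: "\<And>v. v \<in> St \<Longrightarrow> acc P u v \<Longrightarrow> prov 1 (insert B v)" and "X \<subseteq> Cl" for X
    using that(2)
  proof (induction rule: state_induct)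
    case (prov X)
    then have "finite X" using finite_Cl finite_subset by blast
    then have "prov 1 (insert (Disj X) {B})"
      using prov by (intro prov_Disj_intro) (auto elim: prov_mono)
    then have "prov 1 (insert (Or (Disj X) B) {})" by (intro prov_Or) (simp add: insert_commute)
    from prov_Gen[OF this] show ?case by (rule prov_mono) auto
  next
    case (split X C)
    \<comment> \<open>\<open>?C\<close> and \<open>?C'\<close> together imply
      \<open>Or (Disj X) B\<close>. \<open>Gen\<close> carries this implication under the box, and
      two cuts remove the boxed premises.\<close>
    let ?C = "Or (Disj (insert C X)) B" and ?C' = "Or (Disj (insert (neg C) X)) B"
    have "finite X" using split(1) finite_Cl finite_subset by blast
    from prov_Disj_insert_neg[OF this]
    have 1: "prov 1 (insert (neg (Disj (insert C X)))
        (insert (neg (Disj (insert (neg C) X))) {Disj X, B}))"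
      by (rule prov_mono) auto
    have 2: "prov 1 (insert (neg (Disj (insert C X))) (insert (neg ?C') {Disj X, B}))"
      using prov_And[of 1 "neg (Disj (insert (neg C) X))" "insert (neg (Disj (insert C X))) {Disj X, B}" "neg B"]
        1 prov_identity[of B]
      by (simp add: insert_commute)
    have "prov 1 (insert (neg ?C) (insert (neg ?C') {Disj X, B}))"
      using prov_And[OF 2, of "neg B"] prov_identity[of B] by simp
    then have "prov 1 (insert (Or (Disj X) B) {neg ?C, neg ?C'})"
      by (intro prov_Or) (simp add: insert_commute)
    from prov_Gen[OF this, of P]
    have 3: "prov 1 (insert (neg (Box P ?C)) {neg (Box P ?C'), Box P (Or (Disj X) B)})"
      by (simp add: insert_commute)
    from prov_cut_sets[OF split(2) 3, of "insert (neg (Box P ?C')) (insert (Box P (Or (Disj X) B)) u)"]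
    have "prov 1 (insert (neg (Box P ?C')) (insert (Box P (Or (Disj X) B)) u))" by auto
    from prov_cut_sets[OF split(3) this] show ?case by auto
  next
    case (state v)
    show ?case
    proof (cases "acc P u v")
      case True
      then have "prov 1 (insert (Disj v) {B})"
        using none state finite_state by (intro prov_Disj_intro) auto
      then have "prov 1 (insert (Or (Disj v) B) {})" by (intro prov_Or) (simp add: insert_commute)
      from prov_Gen[OF this] show ?thesis by (rule prov_mono) auto
    next
      case False
      then have 1: "prov 1 (insert (Box P (Disj v)) u)" by (simp add: acc_def)
      have "prov 1 (insert (Or (Disj v) B) {neg (Disj v)})"
        by (intro prov_Or) (rule prov_identity[of "Disj v"]; simp)
      from prov_Gen[OF this, of P]
      have "prov 1 (insert (neg (Box P (Disj v))) {Box P (Or (Disj v) B)})"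
        by (simp add: insert_commute)
      from prov_cut_sets[OF 1 this] show ?thesis by auto
    qed
  qed
  from this[of "{}"]
  have *: "prov 1 (insert (Box P (Or (Disj {}) B)) u)"
    if "\<And>v. v \<in> St \<Longrightarrow> acc P u v \<Longrightarrow> prov 1 (insert B v)" using that by blast
  have "prov 1 (insert (And (neg (Disj {})) (neg B)) {B})"
    by (intro prov_And prov_neg_Disj_intro) (auto intro: prov_identity[of B])
  then have "prov 1 (insert B {neg (Or (Disj {}) B)})" by (simp add: insert_commute)
  from prov_Gen[OF this, of P]
  have 1: "prov 1 (insert (neg (Box P (Or (Disj {}) B))) {Box P B})" by (simp add: insert_commute)
  have "prov 1 (insert (Box P B) u)" if "\<And>v. v \<in> St \<Longrightarrow> acc P u v \<Longrightarrow> prov 1 (insert B v)"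
    using prov_cut_sets[OF *[OF that] 1] by auto
  with assms that show thesis by blast
qed

section \<open>Accessibility for compound programs\<close>

lemma acc_Choice: "acc (Choice P R) u v \<Longrightarrow> acc P u v \<or> acc R u v"
  unfolding acc_def using prov_BoxChoice by blast

lemma acc_Comp:
  assumes "acc (Comp P R) u v"
  obtains w where "w \<in> St" "acc P u w" "acc R w v"
proof -
  have "\<not> prov 1 (insert (Box P (Box R (Disj v))) u)"
    using assms prov_BoxComp unfolding acc_def by blast
  \<comment> \<open>With \<open>Box R (Disj v)\<close> in the place of \<open>B\<close>, the last
    property of the successor \<open>w\<close> is just \<open>acc R w v\<close>.\<close>
  from acc_exists[OF this] that show thesis unfolding acc_def by metis
qed

text \<open>
  The invariant \<open>I\<close> says that the current state is reachable from \<open>u\<close> by \<open>P\<close>-steps.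
\<close>

lemma acc_Star:
  assumes "acc (Star P) u v" "u \<in> St" "v \<in> St"
  shows "(u, v) \<in> {(x, y). x \<in> St \<and> y \<in> St \<and> acc P x y}\<^sup>*" (is "_ \<in> ?R\<^sup>*")
proof (rule ccontr)
  assume notin: "(u, v) \<notin> ?R\<^sup>*"
  define W where "W = {w \<in> St. (u, w) \<in> ?R\<^sup>*}"
  \<comment> \<open>\<open>neg (Disj w)\<close> says that all members of \<open>w\<close> are false,
    so it describes the state \<open>w\<close>.\<close>
  define I where "I = Disj ((\<lambda>w. neg (Disj w)) ` W)"
  have W: "finite W" "u \<in> W" "v \<notin> W" "W \<subseteq> St"
    using notin finite_St assms(2) by (auto simp: W_def)
  have reach: "prov 1 (insert I w)" if "w \<in> W" for w
  proof -
    have "prov 1 (insert (neg (Disj w)) w)"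
      using that W finite_state by (intro prov_neg_Disj_member) auto
    then have "prov 1 ((\<lambda>w. neg (Disj w)) ` W \<union> w)"
      by (rule prov_mono) (use that in auto)
    with W(1) show ?thesis unfolding I_def by (intro prov_Disj_intro) auto
  qed
  have neg_I: "prov 1 (insert (neg I) Y)" if "\<And>w. w \<in> W \<Longrightarrow> prov 1 (w \<union> Y)" for Y
    unfolding I_def
  proof (rule prov_neg_Disj_intro)
    fix A assume "A \<in> (\<lambda>w. neg (Disj w)) ` W"
    then obtain w where w: "w \<in> W" "A = neg (Disj w)" by blast
    then show "prov 1 (insert (neg A) Y)"
      using prov_Disj_intro[of w] finite_state W(4) that by auto
  qed (use W(1) in simp)
  have "prov 1 (insert (neg I) {Box P I})"
  proof (rule neg_I)
    fix w assume w: "w \<in> W"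
    have "prov 1 (insert (Box P I) w)"
    proof (rule ccontr)
      assume "\<not> ?thesis"
      then obtain w' where w': "w' \<in> St" "acc P w w'" "\<not> prov 1 (insert I w')"
        using acc_exists by blast
      \<comment> \<open>A successor refuting \<open>I\<close> would still be reachable from
        \<open>u\<close>, where \<open>reach\<close> proves \<open>I\<close>.\<close>
      have "w' \<in> W"
        using w w' unfolding W_def by (auto intro: rtrancl_into_rtrancl)
      with reach w'(3) show False by blast
    qed
    then show "prov 1 (w \<union> {Box P I})" by simp
  qed
  moreover have "prov 1 (insert (neg I) {Disj v})"
  proof (rule neg_I)
    fix w assume w: "w \<in> W"
    then have "w \<noteq> v" "w \<in> St" using W by auto
    \<comment> \<open>Distinct states disagree on some formula of \<open>Cl\<close>; one contains it
      and the other its negation, which makes their union an identity.\<close>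
    then obtain A where "A \<in> Cl" "A \<in> w \<longleftrightarrow> A \<notin> v"
      using assms(3) unfolding St_def by blast
    then have "prov 1 (v \<union> w)"
      using \<open>w \<in> St\<close> assms(3) neg_Cl unfolding St_def
      by (intro prov_identity[of A]) blast+
    then show "prov 1 (w \<union> {Disj v})"
      using prov_Disj_intro[OF finite_state[OF assms(3)]] by simp
  qed
  ultimately have "prov 1 (insert (Box (Star P) (Disj v)) u)"
    using prov_invariant reach W(2) by blast
  with assms(1) show False by (simp add: acc_def)
qed

section \<open>The truth lemma\<close>

lemma body_Cl:
  assumes "M P A \<in> Cl" "M \<in> {Box, Dia}"
  shows "A \<in> Cl"
  using assms(1)
proof (induction P arbitrary: A)
  case (PVar a)
  then show ?case using fl_step_Cl[OF PVar] assms(2) by auto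
next
  case (Comp P R)
  \<comment> \<open>Closure is given for single steps only: \<open>M R A\<close> is reached as the
    body of \<open>P\<close>, and then \<open>A\<close> as the body of \<open>R\<close>.\<close>
  have "M P (M R A) \<in> Cl" using fl_step_Cl[OF Comp.prems] assms(2) by auto
  then show ?case using Comp.IH by blast
next
  case (Choice P R)
  have "M P A \<in> Cl" using fl_step_Cl[OF Choice.prems] assms(2) by auto
  then show ?case using Choice.IH by blast
next
  case (Star P)
  show ?case using fl_step_Cl[OF Star.prems] assms(2) by auto
qed

text \<open>States list false formulas, so a provable implication from \<open>B\<close> to
  \<open>A\<close> carries membership from \<open>A\<close> to \<open>B\<close>.\<close>

lemma state_step:
  assumes "u \<in> St" "A \<in> u" "B \<in> fl_step A" "prov 1 {A, neg B}"
  shows "B \<in> u"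
proof (rule ccontr)
  assume "B \<notin> u"
  have "B \<in> Cl" using assms fl_step_Cl unfolding St_def by blast
  with \<open>B \<notin> u\<close> assms(1) have "neg B \<in> u" unfolding St_def by blast
  then have "prov 1 u" using assms(2,4) by (auto elim: prov_mono)
  with assms(1) show False unfolding St_def by blast
qed

context
  fixes f :: "form set \<Rightarrow> 's"
  assumes f: "inj_on f St"
begin

text \<open>The injection \<open>f\<close> moves the states into the type \<open>'s\<close>. A
  variable is true where its negated literal is listed as false.\<close>

definition canonical :: "'s kripke" where
  "canonical = \<lparr>states = f ` St,
     rel = \<lambda>a. {(f u, f v) | u v. u \<in> St \<and> v \<in> St \<and> acc (PVar a) u v},
     val = \<lambda>x. f ` {u \<in> St. Neg x \<in> u}\<rparr>"

lemma acc_prog_rel: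
  assumes "acc P u v" "u \<in> St" "v \<in> St"
  shows "(f u, f v) \<in> prog_rel canonical P"
  using assms
proof (induction P arbitrary: u v)
  case (PVar a)
  then show ?case by (auto simp: canonical_def)
next
  case (Comp P R)
  then show ?case by (fastforce elim: acc_Comp)
next
  case (Choice P R)
  then show ?case using acc_Choice[OF Choice.prems(1)] by auto
next
  case (Star P)
  from acc_Star[OF Star.prems] have "(f u, f v) \<in> (prog_rel canonical P)\<^sup>*"
    by (induction rule: rtrancl_induct) (auto intro: rtrancl_into_rtrancl Star.IH)
  with Star.prems show ?case by (simp add: canonical_def)
qed

text \<open>Falsity of the diamond is pushed along the path from \<open>f u\<close> to
  \<open>t\<close>, one program constructor at a time, until it reaches \<open>A\<close>.\<close>

lemma Dia_prog_rel:
  assumes "u \<in> St" "(f u, t) \<in> prog_rel canonical P" "Dia P A \<in> u"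
  shows "\<exists>v \<in> St. t = f v \<and> A \<in> v"
  using assms
proof (induction P arbitrary: u t A)
  case (PVar a)
  then obtain v where v: "t = f v" "v \<in> St" "acc (PVar a) u v"
    using f by (auto simp: canonical_def dest: inj_onD)
  have "A \<in> Cl"
    using PVar.prems body_Cl[of Dia] unfolding St_def by blast
  moreover have "\<not> prov 1 (insert A v)"
  proof
    assume "prov 1 (insert A v)"
    then have "prov 1 (insert (Disj v) {A})"
      using v finite_state by (intro prov_Disj_intro) auto
    from prov_Gen[OF this, of "PVar a"] have "prov 1 (insert (Box (PVar a) (Disj v)) u)"
      by (rule prov_mono) (use PVar.prems in auto)
    with v show False by (simp add: acc_def)
  qed
  ultimately show ?case using v state_memberI by blast
next
  case (Comp P R)
  have "Dia P (Dia R A) \<in> u"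
    by (rule state_step[OF Comp.prems(1,3)])
      (auto intro!: prov_DiaComp prov_identity[of "Dia P (Dia R A)"])
  with Comp show ?case by fastforce
next
  case (Choice P R)
  have "Dia P A \<in> u"
    by (rule state_step[OF Choice.prems(1,3)])
      (auto intro!: prov_DiaChoice prov_identity[of "Dia P A"])
  moreover have "Dia R A \<in> u"
    by (rule state_step[OF Choice.prems(1,3)])
      (auto intro!: prov_DiaChoice prov_identity[of "Dia R A"])
  ultimately show ?case using Choice by auto
next
  case (Star P)
  \<comment> \<open>The starred diamond stays false along the whole path by
    \<open>prov_Star_step\<close>; at its end \<open>prov_Star_reflexive\<close> makes
    \<open>A\<close> false.\<close>
  have *: "\<exists>v \<in> St. t = f v \<and> Dia (Star P) A \<in> v" if "(f u, t) \<in> (prog_rel canonical P)\<^sup>*" for t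
    using that
  proof (induction rule: rtrancl_induct)
    case base
    then show ?case using Star.prems by blast
  next
    case (step s t)
    then obtain v where v: "v \<in> St" "s = f v" "Dia (Star P) A \<in> v" by blast
    have "Dia P (Dia (Star P) A) \<in> v"
      by (rule state_step[OF v(1,3)]) (use prov_Star_step[of P A] in auto)
    with Star.IH v step(2) show ?case by blast
  qed
  from Star.prems(2) have "(f u, t) \<in> (prog_rel canonical P)\<^sup>*" by simp
  from *[OF this] obtain v where v: "v \<in> St" "t = f v" "Dia (Star P) A \<in> v" by blast
  have "A \<in> v"
    by (rule state_step[OF v(1,3)]) (use prov_Star_reflexive in auto)
  with v show ?case by blast
qed

text \<open>One direction suffices: a formula of \<open>Cl\<close> outside \<open>u\<close> has its
  negation in \<open>u\<close>.\<close>

lemma truth: "u \<in> St \<Longrightarrow> A \<in> u \<Longrightarrow> \<not> holds canonical (f u) A"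
proof (induction A arbitrary: u)
  case (Pos x)
  then have "Neg x \<notin> u"
    using prov_identity[of "Pos x" u 1] unfolding St_def by auto
  with Pos f show ?case by (auto simp: canonical_def dest: inj_onD)
next
  case (Neg x)
  then show ?case by (auto simp: canonical_def)
next
  case (Or A B)
  have "A \<in> u"
    by (rule state_step[OF Or.prems]) (auto intro!: prov_Or prov_identity[of A])
  moreover have "B \<in> u"
    by (rule state_step[OF Or.prems]) (auto intro!: prov_Or prov_identity[of B])
  ultimately show ?case using Or by auto
next
  case (And A B)
  have "A \<in> u \<or> B \<in> u"
  proof (rule ccontr)
    assume no: "\<not> ?thesis"
    have "A \<in> Cl" "B \<in> Cl" using fl_step_Cl[of "And A B"] And.prems unfolding St_def by auto
    then have "neg A \<in> u" "neg B \<in> u" using no And.prems(1) unfolding St_def by blast+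
    then have "prov 1 (insert (And A B) u)"
      by (intro prov_And) (auto intro: prov_identity[of A] prov_identity[of B])
    with And.prems show False unfolding St_def by (simp add: insert_absorb)
  qed
  with And show ?case by auto
next
  case (Box P A)
  have "\<not> prov 1 (insert (Box P A) u)"
    using Box.prems unfolding St_def by (simp add: insert_absorb)
  then obtain v where v: "v \<in> St" "acc P u v" "\<not> prov 1 (insert A v)"
    using acc_exists by blast
  have "A \<in> Cl" using body_Cl[of Box] Box.prems unfolding St_def by blast
  then have "A \<in> v" using state_memberI v by blast
  with Box.IH[OF v(1)] acc_prog_rel[OF v(2) Box.prems(1) v(1)] show ?case by auto
next
  case (Dia P A)
  then show ?case using Dia_prog_rel[OF Dia.prems(1) _ Dia.prems(2)] by auto
qed

lemma canonical_model: "St \<noteq> {} \<Longrightarrow> kripke_model canonical"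
  by (auto simp: kripke_model_def canonical_def)

end

text \<open>As \<open>St\<close> is finite, it injects into every infinite type.\<close>

lemma countermodel:
  assumes "X \<subseteq> Cl" "\<not> prov 1 X"
  shows "\<exists>(M :: 's::infinite kripke) u. kripke_model M \<and> u \<in> states M \<and> (\<forall>A \<in> X. \<not> holds M u A)"
proof -
  obtain v where v: "v \<in> St" "X \<subseteq> v" using state_extension[OF assms] .
  obtain B :: "'s set" where B: "finite B" "card B = card St"
    using infinite_arbitrarily_large[OF infinite_UNIV] by blast
  obtain f :: "form set \<Rightarrow> 's" where "bij_betw f St B"
    using finite_same_card_bij[OF finite_St B(1)] B(2) by metis
  then have f: "inj_on f St" by (rule bij_betw_imp_inj_on)
  show ?thesis
  proof (intro exI conjI ballI)
    show "kripke_model (canonical f)" using canonical_model[OF f] v by blast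
    show "f v \<in> states (canonical f)" using v by (simp add: canonical_def[OF f])
    show "\<not> holds (canonical f) (f v) A" if "A \<in> X" for A
      using truth[OF f v(1)] v(2) that by blast
  qed
qed

end

section \<open>Completeness and the ordinal bound\<close>

theorem completeness:
  assumes "seq_valid TYPE('s::infinite) \<Gamma>"
  shows "derivable_level 1 \<Gamma>"
proof -
  define F where "F = (\<Union>A \<in> set_mset \<Gamma>. fl A)"
  have step: "fl_step A \<subseteq> F" if "A \<in> F" for A
    using that fl_step_fl unfolding F_def by blast
  \<comment> \<open>\<open>fl_step\<close> commutes with \<open>neg\<close>, so adding the negations
    preserves closure under steps.\<close>
  interpret fl_closed "F \<union> neg ` F"
  proof
    show "finite (F \<union> neg ` F)" by (auto simp: F_def finite_fl)
    show "neg A \<in> F \<union> neg ` F" if "A \<in> F \<union> neg ` F" for A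
      using that by auto
    show "fl_step A \<subseteq> F \<union> neg ` F" if "A \<in> F \<union> neg ` F" for A
    proof (cases "A \<in> F")
      case False
      then obtain B where "B \<in> F" "A = neg B" using \<open>A \<in> F \<union> neg ` F\<close> by blast
      then show ?thesis using image_mono[OF step, of B neg] by (auto simp: fl_step_neg)
    qed (use step in blast)
  qed
  have "set_mset \<Gamma> \<subseteq> F \<union> neg ` F" using fl_self by (auto simp: F_def)
  from countermodel[OF this, where 's = 's] assms have "prov 1 (set_mset \<Gamma>)"
    unfolding seq_valid_def by metis
  then show ?thesis by (simp add: prov_set_mset)
qed

theorem theorem4:
  fixes \<Gamma> :: sequent and A :: form
  shows "(derivable \<Gamma> \<longleftrightarrow> seq_valid TYPE('s::infinite) \<Gamma>) \<and>
         (seq_valid TYPE('s) \<Gamma> \<longrightarrow> derivable_below omega_times_2 \<Gamma>) \<and>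
         (form_valid TYPE('s) A \<longrightarrow> derivable_below omega_times_2 {#A#})"
proof -
  \<comment> \<open>The labels of level 1 have the form \<open>(1, k)\<close> and thus lie below
    \<open>(2, 0)\<close>.\<close>
  have below: "derivable_below omega_times_2 \<Delta>" if "seq_valid TYPE('s) \<Delta>" for \<Delta>
    using completeness[OF that]
    unfolding derivable_below_def omega_times_2_def derivable_level_def
    by (metis less_prod_simp one_less_numeral_iff semiring_norm(76))
  have "derivable \<Gamma>" if "seq_valid TYPE('s) \<Gamma>"
    using below[OF that] derivable_ord_derivable unfolding derivable_below_def by blast
  moreover have "seq_valid TYPE('s) {#A#}" if "form_valid TYPE('s) A"
    using that by (simp add: seq_valid_def form_valid_def)
  ultimately show ?thesis using soundness below by blast
qed

end
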